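(* Let $\mathcal{G}$ be a set of $n$-qubit Pauli strings, $H=\sum_{g\in\mathcal{G}}c_g\,g$ with real coefficients $c_g$, $p$ a Pauli string, $C_p$ the connected component of $p$ in the commutator graph of $\mathcal{G}$, and $p_t=e^{iHt}pe^{-iHt}=\sum_{q\in C_p}c_q(t)\,q$. Then the graph complexity $$\mathsf{G}(p_t)=\sum_{q\in C_p}\ell(p,q)\,|c_q(t)|^2$$ is a $q$-complexity on the component to which $p$ belongs, i.e. on the operator space $\mathrm{span}_{\mathbb C}(C_p)$.
   Context: $d=2^n$. A Pauli string is an operator $\sigma_1\otimes\cdots\otimes\sigma_n$ with each $\sigma_i\in\{I,X,Y,Z\}$. The commutator graph of $\mathcal{G}$ is the undirected graph whose vertices are all $4^n$ Pauli strings, with an edge between $p$ and $q$ iff there is $g\in\mathcal{G}$ such that $[g,p]$ is a nonzero scalar multiple of $q$. $\ell(p,q)$ is the length of a shortest path between $p$ and $q$ in this graph. Operators are regarded as vectors $|O\rangle\!\rangle$ with inner product $\langle\!\langle O|O'\rangle\!\rangle=\frac1d\mathrm{tr}[O^\dagger O']$ (Pauli strings are then orthonormal). The Liouvillian superoperator is $\mathsf L=[H,\cdot\,]$, so $O_t=e^{i\mathsf Lt}O$ is the Heisenberg evolution of $O$; it preserves $\mathrm{span}_{\mathbb C}(C_p)$. A $q$-complexity of $O_t$ (for initial operator $O$), on an $\mathsf{L}$-invariant operator space containing $O$, is an expectation value $\mathsf{Q}(O_t)=\langle\!\langle O_t|\mathcal{Q}|O_t\rangle\!\rangle$, where $\mathcal{Q}$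 is a ($t$-independent) superoperator on that space such that: (1) $\mathcal{Q}$ is positive semidefinite, with a spectral decomposition $\mathcal{Q}=\sum_a q_a|q_a\rangle\!\rangle\langle\!\langle q_a|$ in an orthonormal eigenbasis, $q_a\ge0$ for all $a$; (2) there exists $M>0$ such that $\langle\!\langle q_a|\mathsf{L}|q_b\rangle\!\rangle=0$ whenever $|q_a-q_b|>M$, and $\langle\!\langle q_a|O\rangle\!\rangle=0$ whenever $|q_a|>M$. *)

theory Defs
  imports "HOL-Analysis.Analysis" "Graph_Theory.Digraph_Component"
begin

section \<open>Operators on n qubits\<close>

text \<open>
  The number \<open>n\<close> of qubits is \<open>CARD('n)\<close>. The computational basis of the \<open>2 ^ n\<close>-dimensional
  Hilbert space is indexed by bit strings \<open>'n \<Rightarrow> bool\<close>, with \<open>False\<close> for the basis vector 0 and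
  \<open>True\<close> for the basis vector 1 of a single qubit.
\<close>

type_synonym 'n operator = "complex ^ ('n \<Rightarrow> bool) ^ ('n \<Rightarrow> bool)"

text \<open>
  The library multiplies matrices by \<open>**\<close>; on the type \<open>vec\<close> the operations \<open>*\<close>, \<open>^\<close> and \<open>exp\<close>
  are not the matrix ones, and there is no multiplication of a complex matrix by a complex scalar.
\<close>

definition mat_scale :: "complex \<Rightarrow> complex ^ 'm ^ 'k \<Rightarrow> complex ^ 'm ^ 'k"  (infixr \<open>*\<^sub>C\<close> 75)
  where "z *\<^sub>C A = (\<chi> i j. z * A $ i $ j)"

global_interpretation cmat: vector_space "mat_scale :: complex \<Rightarrow> complex ^ 'm::finite ^ 'k::finite \<Rightarrow> _"
  by unfold_locales (simp_all add: mat_scale_def vec_eq_iff algebra_simps)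

definition adjoint_mat :: "complex ^ 'm ^ 'm \<Rightarrow> complex ^ 'm ^ 'm"
  where "adjoint_mat A = (\<chi> i j. cnj (A $ j $ i))"

definition commutator :: "complex ^ 'm ^ 'm \<Rightarrow> complex ^ 'm ^ 'm \<Rightarrow> complex ^ 'm ^ 'm"
  where "commutator A B = A ** B - B ** A"

definition op_inner :: "'n::finite operator \<Rightarrow> 'n operator \<Rightarrow> complex"
  where "op_inner A B = (1 / 2 ^ CARD('n)) * trace (adjoint_mat A ** B)"

definition mat_exp :: "complex ^ 'm ^ 'm \<Rightarrow> complex ^ 'm ^ 'm"
  where "mat_exp A = (\<Sum>k. (1 / fact k) *\<^sub>C (((**) A ^^ k) (mat 1)))"


section \<open>Pauli strings and the commutator graph\<close>

datatype pauli = Pauli_I | Pauli_X | Pauli_Y | Pauli_Z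

fun pauli_entry :: "pauli \<Rightarrow> bool \<Rightarrow> bool \<Rightarrow> complex" where
  "pauli_entry Pauli_I a b = (if a = b then 1 else 0)"
| "pauli_entry Pauli_X a b = (if a = b then 0 else 1)"
| "pauli_entry Pauli_Y a b = (if a = b then 0 else if a then \<i> else - \<i>)"
| "pauli_entry Pauli_Z a b = (if a = b then if a then - 1 else 1 else 0)"

text \<open>An entry of a tensor product is the product of the entries of its factors.\<close>

definition pauli_string :: "('n::finite \<Rightarrow> pauli) \<Rightarrow> 'n operator"
  where "pauli_string \<sigma> = (\<chi> i j. \<Prod>k\<in>UNIV. pauli_entry (\<sigma> k) (i k) (j k))"

definition pauli_strings :: "'n::finite operator set"
  where "pauli_strings = range pauli_string"

text \<open>
  Graphs are encoded as digraphs with a symmetric arc relation; \<open>pair_graph_commutator_graph\<close>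
  below shows that this is the case here.
\<close>

definition commutator_graph :: "'n::finite operator set \<Rightarrow> 'n operator pair_pre_digraph"
  where "commutator_graph \<G> =
    \<lparr> pverts = pauli_strings,
      parcs = {(p, q). p \<in> pauli_strings \<and> q \<in> pauli_strings \<and>
                 (\<exists>g\<in>\<G>. \<exists>z. z \<noteq> 0 \<and> commutator g p = z *\<^sub>C q)} \<rparr>"

definition component :: "'n::finite operator set \<Rightarrow> 'n operator \<Rightarrow> 'n operator set"
  where "component \<G> p = pre_digraph.scc_of (with_proj (commutator_graph \<G>)) p"

definition graph_dist :: "'n::finite operator set \<Rightarrow> 'n operator \<Rightarrow> 'n operator \<Rightarrow> nat"
  where "graph_dist \<G> p q =
    (LEAST k. \<exists>es. pre_digraph.apath (with_proj (commutator_graph \<G>)) p es q \<and> length es = k)"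


section \<open>Heisenberg evolution and q-complexities\<close>

type_synonym 'n superoperator = "'n operator \<Rightarrow> 'n operator"

definition liouvillian :: "'n::finite operator \<Rightarrow> 'n superoperator"
  where "liouvillian H = commutator H"

definition superop_exp :: "'n::finite superoperator \<Rightarrow> 'n superoperator"
  where "superop_exp S A = (\<Sum>k. (1 / fact k) *\<^sub>C ((S ^^ k) A))"

definition evolve :: "'n::finite superoperator \<Rightarrow> 'n operator \<Rightarrow> real \<Rightarrow> 'n operator"
  where "evolve L A t = superop_exp (\<lambda>B. (\<i> * complex_of_real t) *\<^sub>C L B) A"

definition superoperator_on :: "'n::finite operator set \<Rightarrow> 'n superoperator \<Rightarrow> bool"
  where "superoperator_on V S \<longleftrightarrow>
    (\<forall>A\<in>V. S A \<in> V) \<and>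
    (\<forall>A\<in>V. \<forall>B\<in>V. S (A + B) = S A + S B) \<and>
    (\<forall>z. \<forall>A\<in>V. S (z *\<^sub>C A) = z *\<^sub>C S A)"

definition psd_on :: "'n::finite operator set \<Rightarrow> 'n superoperator \<Rightarrow> bool"
  where "psd_on V S \<longleftrightarrow> (\<forall>A\<in>V. op_inner A (S A) \<in> \<real>\<^sub>\<ge>\<^sub>0)"

definition orthonormal_basis_of :: "'n::finite operator set \<Rightarrow> 'n operator set \<Rightarrow> bool"
  where "orthonormal_basis_of V E \<longleftrightarrow>
    (\<forall>a\<in>E. \<forall>b\<in>E. op_inner a b = (if a = b then 1 else 0)) \<and> cmat.span E = V"

text \<open>
  An orthonormal eigenbasis \<open>E\<close> is indexed by itself: \<open>ev a\<close> is the eigenvalue of the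
  eigenoperator \<open>a\<close>, and different elements of \<open>E\<close> may have the same eigenvalue.
\<close>

definition spectral_decomposition ::
    "'n::finite operator set \<Rightarrow> 'n superoperator \<Rightarrow> 'n operator set \<Rightarrow> ('n operator \<Rightarrow> real) \<Rightarrow> bool"
  where "spectral_decomposition V Q E ev \<longleftrightarrow>
    orthonormal_basis_of V E \<and>
    (\<forall>A\<in>V. Q A = (\<Sum>a\<in>E. (complex_of_real (ev a) * op_inner a A) *\<^sub>C a))"

text \<open>
  \<open>f\<close>, as a function of time, is a q-complexity of the evolution of \<open>A\<close> generated by \<open>L\<close>, on the
  operator space \<open>V\<close>.
\<close>

definition q_complexity_on ::
    "'n::finite operator set \<Rightarrow> 'n superoperator \<Rightarrow> 'n operator \<Rightarrow> (real \<Rightarrow> real) \<Rightarrow> bool"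
  where "q_complexity_on V L A f \<longleftrightarrow>
    cmat.subspace V \<and> superoperator_on V L \<and> A \<in> V \<and>
    (\<exists>Q E ev.
      superoperator_on V Q \<and> psd_on V Q \<and>
      spectral_decomposition V Q E ev \<and> (\<forall>a\<in>E. ev a \<ge> 0) \<and>
      (\<exists>M>0.
        (\<forall>a\<in>E. \<forall>b\<in>E. \<bar>ev a - ev b\<bar> > M \<longrightarrow> op_inner a (L b) = 0) \<and>
        (\<forall>a\<in>E. \<bar>ev a\<bar> > M \<longrightarrow> op_inner a A = 0)) \<and>
      (\<forall>t. complex_of_real (f t) = op_inner (evolve L A t) (Q (evolve L A t))))"

text \<open>\<open>c q\<close> is the coefficient of \<open>q\<close> in the expansion of an operator over \<open>component \<G> p\<close>.\<close>

definition graph_complexity ::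
    "'n::finite operator set \<Rightarrow> 'n operator \<Rightarrow> ('n operator \<Rightarrow> complex) \<Rightarrow> real"
  where "graph_complexity \<G> p c = (\<Sum>q\<in>component \<G> p. real (graph_dist \<G> p q) * (cmod (c q))\<^sup>2)"


section \<open>Orthonormality of the Pauli strings; the commutator graph is undirected\<close>

lemma pauli_string_mult_nth:
  "(pauli_string \<sigma> ** pauli_string \<tau>) $ i $ j =
     (\<Prod>m\<in>UNIV. \<Sum>b\<in>UNIV. pauli_entry (\<sigma> m) (i m) b * pauli_entry (\<tau> m) b (j m))"
proof -
  have "(\<Prod>m\<in>(UNIV :: 'a set). \<Sum>b\<in>(UNIV :: bool set). pauli_entry (\<sigma> m) (i m) b * pauli_entry (\<tau> m) b (j m))
     = (\<Sum>k\<in>PiE UNIV (\<lambda>_. UNIV). \<Prod>m\<in>UNIV. pauli_entry (\<sigma> m) (i m) (k m) * pauli_entry (\<tau> m) (k m) (j m))"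
    by (rule prod_sum_PiE) auto
  then show ?thesis
    by (simp add: matrix_matrix_mult_def pauli_string_def prod.distrib PiE_UNIV_domain)
qed

lemma op_inner_pauli_string:
  "op_inner (pauli_string \<sigma>) (pauli_string \<tau>) = (if \<sigma> = \<tau> then 1 else 0)"
proof -
  have "cnj (pauli_entry s a b) = pauli_entry s b a" for s a b
    by (cases s; cases a; cases b) simp_all
  then have adj: "adjoint_mat (pauli_string \<sigma>) = pauli_string \<sigma>"
    by (simp add: adjoint_mat_def pauli_string_def vec_eq_iff)
  have *: "(\<Sum>a\<in>UNIV. \<Sum>b\<in>UNIV. pauli_entry s a b * pauli_entry t b a) = (if s = t then 2 else 0)" for s t
    by (cases s; cases t) (simp_all add: UNIV_bool)
  have "trace (pauli_string \<sigma> ** pauli_string \<tau>)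
     = (\<Sum>i\<in>PiE UNIV (\<lambda>_. UNIV). \<Prod>m\<in>UNIV. \<Sum>b\<in>UNIV. pauli_entry (\<sigma> m) (i m) b * pauli_entry (\<tau> m) b (i m))"
    by (simp add: trace_def pauli_string_mult_nth PiE_UNIV_domain)
  also have "\<dots> = (\<Prod>m\<in>UNIV. \<Sum>a\<in>UNIV. \<Sum>b\<in>UNIV. pauli_entry (\<sigma> m) a b * pauli_entry (\<tau> m) b a)"
    by (rule prod_sum_PiE[symmetric]) auto
  also have "\<dots> = (\<Prod>m\<in>UNIV. if \<sigma> m = \<tau> m then 2 else 0)"
    by (simp add: *)
  also have "\<dots> = (if \<sigma> = \<tau> then 2 ^ CARD('a) else 0)"
    by (auto simp: fun_eq_iff)
  finally show ?thesis
    by (simp add: op_inner_def adj)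
qed

lemma card_pauli_strings: "card (pauli_strings :: 'n::finite operator set) = 4 ^ CARD('n)"
proof -
  have inj: "inj (pauli_string :: ('n \<Rightarrow> pauli) \<Rightarrow> _)"
    by (rule injI) (metis op_inner_pauli_string zero_neq_one)
  have P: "(UNIV :: pauli set) = {Pauli_I, Pauli_X, Pauli_Y, Pauli_Z}"
    using pauli.exhaust by auto
  have U: "card (UNIV :: pauli set) = 4" by (simp add: P)
  have "card (PiE (UNIV :: 'n set) (\<lambda>_. UNIV :: pauli set)) = 4 ^ CARD('n)"
    by (subst card_PiE) (simp_all add: U)
  with inj show ?thesis
    by (simp add: pauli_strings_def card_image PiE_UNIV_domain)
qed

lemma pauli_string_square: "pauli_string \<sigma> ** pauli_string \<sigma> = mat 1"
proof -
  have *: "(\<Sum>c\<in>UNIV. pauli_entry s a c * pauli_entry s c b) = (if a = b then 1 else 0)" for s a b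
    by (cases s; cases a; cases b) (simp_all add: UNIV_bool)
  show ?thesis
    by (auto simp: vec_eq_iff pauli_string_mult_nth * mat_def fun_eq_iff)
qed

lemma pauli_string_commute_or_anticommute:
  "\<exists>e\<in>{1, -1}. pauli_string \<sigma> ** pauli_string \<tau> = e *\<^sub>C (pauli_string \<tau> ** pauli_string \<sigma>)"
proof -
  define s where "s m = (if \<sigma> m = Pauli_I \<or> \<tau> m = Pauli_I \<or> \<sigma> m = \<tau> m then 1 else - 1 :: complex)" for m
  have *: "(\<Sum>c\<in>UNIV. pauli_entry (\<sigma> m) a c * pauli_entry (\<tau> m) c b) =
      s m * (\<Sum>c\<in>UNIV. pauli_entry (\<tau> m) a c * pauli_entry (\<sigma> m) c b)" for m a b
    by (cases "\<sigma> m"; cases "\<tau> m"; cases a; cases b) (simp_all add: UNIV_bool s_def)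
  have "(\<Prod>m\<in>M. s m) \<in> {1, -1}" if "finite M" for M
    using that by (induction M) (auto simp: s_def)
  then have "(\<Prod>m\<in>UNIV. s m) \<in> {1, -1}" by simp
  moreover have "pauli_string \<sigma> ** pauli_string \<tau> =
      (\<Prod>m\<in>UNIV. s m) *\<^sub>C (pauli_string \<tau> ** pauli_string \<sigma>)"
    by (simp add: vec_eq_iff pauli_string_mult_nth * mat_scale_def prod.distrib)
  ultimately show ?thesis by blast
qed

lemma pauli_string_nonzero: "pauli_string \<sigma> \<noteq> 0"
proof
  assume "pauli_string \<sigma> = 0"
  then have "pauli_string \<sigma> ** pauli_string \<sigma> = 0"
    by (simp add: matrix_matrix_mult_def vec_eq_iff)
  then have "(mat 1 :: 'a operator) $ undefined $ undefined = 0"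
    by (simp add: pauli_string_square)
  then show False by (simp add: mat_def)
qed

lemma mat_scale_matrix_mult:
  fixes A B :: "complex ^ 'm::finite ^ 'm"
  shows "(z *\<^sub>C A) ** B = z *\<^sub>C (A ** B)" "A ** (z *\<^sub>C B) = z *\<^sub>C (A ** B)"
  by (simp_all add: matrix_matrix_mult_def mat_scale_def vec_eq_iff sum_distrib_left algebra_simps)

lemma commutator_pauli_eq:
  assumes "g \<in> pauli_strings" "p \<in> pauli_strings" "z \<noteq> 0" "q \<in> pauli_strings"
    and eq: "commutator g p = z *\<^sub>C q"
  shows "p ** g = - (g ** p)" and "g ** p = (z / 2) *\<^sub>C q"
proof -
  obtain \<sigma> \<tau> \<rho> where [simp]: "g = pauli_string \<sigma>" "p = pauli_string \<tau>" "q = pauli_string \<rho>"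
    using assms by (auto simp: pauli_strings_def)
  obtain e where e: "e \<in> {1, -1}" "p ** g = e *\<^sub>C (g ** p)"
    using pauli_string_commute_or_anticommute[of \<tau> \<sigma>] that by fastforce
  have "e \<noteq> 1"
  proof
    assume "e = 1"
    then have "z *\<^sub>C q = 0" using e eq by (simp add: commutator_def)
    then show False using assms(3) pauli_string_nonzero[of \<rho>] by simp
  qed
  then show *: "p ** g = - (g ** p)" using e by auto
  have "z *\<^sub>C q = 2 *\<^sub>C (g ** p)"
    using eq * by (simp add: commutator_def mat_scale_def vec_eq_iff)
  then show "g ** p = (z / 2) *\<^sub>C q"
    by (simp add: mat_scale_def vec_eq_iff field_simps)
qed

lemma commutator_pauli_sym:
  assumes "g \<in> pauli_strings" "p \<in> pauli_strings" "z \<noteq> 0" "q \<in> pauli_strings"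
    and eq: "commutator g p = z *\<^sub>C q"
  shows "commutator g q = (4 / z) *\<^sub>C p"
proof -
  note * = commutator_pauli_eq[OF assms]
  have gg: "g ** g = mat 1"
    using assms by (auto simp: pauli_strings_def pauli_string_square)
  have "commutator g (g ** p) = g ** (g ** p) - g ** (p ** g)"
    by (simp add: commutator_def matrix_mul_assoc)
  also have "g ** (p ** g) = - (g ** (g ** p))"
    using *(1) mat_scale_matrix_mult(2)[of g "-1" "g ** p"] by simp
  also have "g ** (g ** p) = p"
    by (simp add: matrix_mul_assoc gg)
  finally have c: "commutator g (g ** p) = p + p" by simp
  have "commutator g (g ** p) = (z / 2) *\<^sub>C commutator g q"
    unfolding *(2) commutator_def by (simp add: mat_scale_matrix_mult cmat.scale_right_diff_distrib)
  then have "(2 / z) *\<^sub>C (p + p) = commutator g q"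
    using c \<open>z \<noteq> 0\<close> by simp
  then show ?thesis
    by (simp add: mat_scale_def vec_eq_iff field_simps)
qed

lemma pair_graph_commutator_graph:
  fixes \<G> :: "'n::finite operator set"
  assumes "\<G> \<subseteq> pauli_strings"
  shows "pair_graph (commutator_graph \<G>)"
proof -
  have fin: "finite (pauli_strings :: 'n operator set)"
    by (rule card_ge_0_finite) (simp add: card_pauli_strings)
  have loop: "p \<noteq> q" if "g \<in> pauli_strings" "p \<in> pauli_strings" "q \<in> pauli_strings" "z \<noteq> 0"
    "commutator g p = z *\<^sub>C q" for g p q :: "'n operator" and z
  proof
    assume "p = q"
    note * = commutator_pauli_eq[OF that(1,2,4,3,5)]
    have pp: "p ** p = mat 1"
      using that by (auto simp: pauli_strings_def pauli_string_square)
    have g: "g = (z / 2) *\<^sub>C mat 1"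
      using arg_cong[OF *(2), of "\<lambda>A. A ** p"] \<open>p = q\<close>
      by (simp add: mat_scale_matrix_mult pp[unfolded \<open>p = q\<close>] flip: matrix_mul_assoc)
    have "commutator g p = 0"
      by (simp add: g commutator_def mat_scale_matrix_mult)
    then show False
      using that by (auto simp: pauli_strings_def pauli_string_nonzero)
  qed
  have sym: "\<exists>g\<in>\<G>. \<exists>z. z \<noteq> 0 \<and> commutator g q = z *\<^sub>C p"
    if "g \<in> \<G>" "p \<in> pauli_strings" "q \<in> pauli_strings" "z \<noteq> 0" "commutator g p = z *\<^sub>C q"
    for g p q z
    using that assms commutator_pauli_sym[of g p z q] by (intro bexI[of _ g] exI[of _ "4 / z"]) auto
  have "finite (parcs (commutator_graph \<G>))"
    by (rule finite_subset[of _ "pauli_strings \<times> pauli_strings"])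
      (auto simp: commutator_graph_def fin)
  moreover have "symmetric (with_proj (commutator_graph \<G>))"
    unfolding symmetric_def with_proj_simps
    by (rule symI) (auto simp: commutator_graph_def intro: sym)
  ultimately show ?thesis
    by unfold_locales (use assms loop in \<open>auto simp: commutator_graph_def fin\<close>)
qed

end

theory Submission
  imports Defs
begin

text \<open>
  The Pauli strings in the component \<open>C\<close> of \<open>p\<close> are orthonormal, and \<open>G\<close> is the expectation value
  of the superoperator that is diagonal in this basis with eigenvalues \<open>\<ell>(p, q)\<close>. For a generator
  \<open>g\<close> and a Pauli string \<open>q\<close> the commutator \<open>[g, q]\<close> is zero or a multiple of a neighbour of \<open>q\<close>, so
  the Liouvillian preserves the span of \<open>C\<close> and has no matrix elements between strings whose distances
  from \<open>p\<close> differ by more than 1; hence \<open>M = 1\<close> works. That conjugation by \<open>exp(iHt)\<close> equals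
  \<open>exp(i[H, \<cdot>]t)\<close> is read off the Cauchy product of the two exponential series.
\<close>

section \<open>Simple paths in digraphs: cutting off a front part and appending an arc\<close>

lemma (in wf_digraph) apath_suffix:
  assumes "apath u es v" "w \<in> set (awalk_verts u es)"
  shows "\<exists>es'. apath w es' v \<and> length es' \<le> length es"
  using assms
proof (induction es arbitrary: u)
  case (Cons e es)
  show ?case
  proof (cases "w = u")
    case False
    then have "\<exists>es'. apath w es' v \<and> length es' \<le> length es"
      using Cons.prems by (intro Cons.IH[of "head G e"]) (auto simp: apath_Cons_iff)
    then show ?thesis by fastforce
  qed (use Cons.prems in blast)
qed auto

text \<open>Appending an arc may revisit a vertex, while \<open>graph_dist\<close> minimises over
  paths without repetition. So the induction works from the front: the rest of the path is extended
  first, and if \<open>u\<close> already lies on the result, the suffix starting at \<open>u\<close>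
  is taken instead.\<close>

lemma (in wf_digraph) apath_snoc_arc:
  assumes "apath u es v" "e \<in> arcs G" "tail G e = v"
  shows "\<exists>es'. apath u es' (head G e) \<and> length es' \<le> Suc (length es)"
  using assms
proof (induction es arbitrary: u)
  case Nil
  \<comment> \<open>If \<open>e\<close> is a loop, \<open>[e]\<close> would visit \<open>u\<close>
    twice, so the empty path takes its place.\<close>
  then have "apath u (if u = head G e then [] else [e]) (head G e)"
    by (auto simp: apath_simps)
  then show ?case by fastforce
next
  case (Cons e' es)
  then obtain es' where es': "apath (head G e') es' (head G e)" "length es' \<le> Suc (length es)"
    by (auto simp: apath_Cons_iff)
  show ?case
  proof (cases "u \<in> set (awalk_verts (head G e') es')")
    case True
    with es' apath_suffix show ?thesis by fastforce
  next
    case False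
    with es' Cons.prems show ?thesis
      by (intro exI[of _ "e' # es'"]) (auto simp: apath_Cons_iff)
  qed
qed

section \<open>The component of \<open>p\<close> and the distances from \<open>p\<close>\<close>

lemma pverts_commutator_graph: "pverts (commutator_graph \<G>) = pauli_strings"
  by (simp add: commutator_graph_def)

lemma finite_pauli_strings: "finite (pauli_strings :: 'n::finite operator set)"
  by (rule card_ge_0_finite) (simp add: card_pauli_strings)

context
  fixes \<G> :: "'n::finite operator set" and p :: "'n operator"
  assumes generators: "\<G> \<subseteq> pauli_strings"
begin

interpretation pair_graph "commutator_graph \<G>"
  using generators by (rule pair_graph_commutator_graph)

lemma component_subset: "component \<G> p \<subseteq> pauli_strings"
proof
  fix q
  assume "q \<in> component \<G> p"
  then have "p \<rightarrow>\<^sup>*\<^bsub>with_proj (commutator_graph \<G>)\<^esub> q"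
    by (simp add: component_def scc_of_def)
  then have "q \<in> pverts (commutator_graph \<G>)"
    by (rule reachable_in_verts)
  then show "q \<in> pauli_strings" by (simp add: pverts_commutator_graph)
qed

lemma self_in_component:
  assumes "p \<in> pauli_strings"
  shows "p \<in> component \<G> p"
  using assms unfolding component_def by (simp add: in_scc_of_self pverts_commutator_graph)

lemma component_closed:
  assumes "q \<in> component \<G> p" "(q, r) \<in> parcs (commutator_graph \<G>)"
  shows "r \<in> component \<G> p"
proof -
  have "p \<rightarrow>\<^sup>*\<^bsub>with_proj (commutator_graph \<G>)\<^esub> q"
    using assms by (auto simp: component_def scc_of_def)
  then have "p \<rightarrow>\<^sup>*\<^bsub>with_proj (commutator_graph \<G>)\<^esub> r"
    using assms(2) by (rule reachable_adj_trans)
  then show ?thesis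
    unfolding component_def by (intro scc_ofI_reachable')
qed

lemma graph_dist_self:
  assumes "p \<in> pauli_strings"
  shows "graph_dist \<G> p p = 0"
  using assms unfolding graph_dist_def
  by (intro Least_eq_0) (simp add: apath_Nil_iff pverts_commutator_graph)

text \<open>A shortest path to \<open>q\<close>, extended by the arc to \<open>r\<close> and pruned
  to a simple path, bounds the distance of \<open>r\<close>.\<close>

lemma graph_dist_arc_le:
  assumes "q \<in> component \<G> p" "(q, r) \<in> parcs (commutator_graph \<G>)"
  shows "graph_dist \<G> p r \<le> Suc (graph_dist \<G> p q)"
proof -
  have "p \<rightarrow>\<^sup>*\<^bsub>with_proj (commutator_graph \<G>)\<^esub> q"
    using assms by (auto simp: component_def scc_of_def)
  \<comment> \<open>The \<open>LEAST\<close> in \<open>graph_dist\<close> is attained only if some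
    path exists; reachability of \<open>q\<close> provides one.\<close>
  then have "\<exists>k es. apath p es q \<and> length es = k"
    by (auto simp: reachable_apath)
  then have "\<exists>es. apath p es q \<and> length es = graph_dist \<G> p q"
    unfolding graph_dist_def by (rule LeastI_ex)
  then obtain es where es: "apath p es q" "length es = graph_dist \<G> p q" by blast
  with apath_snoc_arc[of p es q "(q, r)"] assms
  obtain es' where "apath p es' r" "length es' \<le> Suc (graph_dist \<G> p q)"
    by auto
  then show ?thesis
    unfolding graph_dist_def[of _ _ r] by (intro order.trans[OF Least_le]) auto
qed

text \<open>The arc relation is symmetric, so the one-sided bound applies in both
  directions.\<close>

lemma graph_dist_arc:
  assumes "q \<in> component \<G> p" "(q, r) \<in> parcs (commutator_graph \<G>)"
  shows "\<bar>real (graph_dist \<G> p r) - real (graph_dist \<G> p q)\<bar> \<le> 1"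
proof -
  have "(r, q) \<in> parcs (commutator_graph \<G>)"
    using assms graph_symmetric by simp
  then have "graph_dist \<G> p q \<le> Suc (graph_dist \<G> p r)"
    using component_closed[OF assms] by (rule graph_dist_arc_le[rotated])
  with graph_dist_arc_le[OF assms] show ?thesis by simp
qed

end

section \<open>Entrywise convergence of the matrix exponential\<close>

lemma mat_scale_nth [simp]: "(z *\<^sub>C A) $ i $ j = z * A $ i $ j"
  by (simp add: mat_scale_def)

lemma sums_matI:
  fixes f :: "nat \<Rightarrow> complex ^ 'm::finite ^ 'k::finite"
  assumes "\<And>i j. (\<lambda>n. f n $ i $ j) sums (s $ i $ j)"
  shows "f sums s"
  using assms unfolding sums_def
  by (intro vec_tendstoI) (simp add: sum_component)

text \<open>The summand of \<open>mat_exp\<close>, named so that the series can enter a Cauchy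
  product.\<close>

definition exp_term :: "complex ^ 'm::finite ^ 'm \<Rightarrow> nat \<Rightarrow> complex ^ 'm ^ 'm"
  where "exp_term A k = (1 / fact k) *\<^sub>C (((**) A ^^ k) (mat 1))"

text \<open>\<open>K\<close> dominates every row sum of \<open>A\<close>, so each further factor
  \<open>A\<close> multiplies a uniform bound on the entries by at most \<open>K\<close>.\<close>

lemma norm_matrix_power_nth_le:
  fixes A :: "complex ^ 'm::finite ^ 'm"
  defines "K \<equiv> \<Sum>i\<in>UNIV. \<Sum>j\<in>UNIV. norm (A $ i $ j)"
  shows "norm ((((**) A ^^ k) (mat 1)) $ i $ j) \<le> K ^ k"
proof (induction k arbitrary: i)
  case (Suc k)
  have K: "0 \<le> K" unfolding K_def by (intro sum_nonneg) simp
  have "norm ((((**) A ^^ Suc k) (mat 1)) $ i $ j)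
      \<le> (\<Sum>l\<in>UNIV. norm (A $ i $ l * (((**) A ^^ k) (mat 1)) $ l $ j))"
    by (simp add: matrix_matrix_mult_def norm_sum)
  also have "\<dots> \<le> (\<Sum>l\<in>UNIV. norm (A $ i $ l) * K ^ k)"
    by (intro sum_mono) (auto simp: norm_mult intro: mult_left_mono Suc.IH)
  also have "\<dots> = (\<Sum>l\<in>UNIV. norm (A $ i $ l)) * K ^ k"
    by (simp add: sum_distrib_right)
  also have "\<dots> \<le> K * K ^ k"
    unfolding K_def
    by (intro mult_right_mono member_le_sum[of i UNIV "\<lambda>i. \<Sum>l\<in>UNIV. norm (A $ i $ l)"])
      (auto intro: sum_nonneg simp: K[unfolded K_def])
  finally show ?case by simp
qed (simp add: mat_def)

text \<open>Comparison with the scalar series of \<open>exp K\<close>. Absolute convergence is what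
  the Cauchy product below requires.\<close>

lemma summable_norm_exp_term_nth: "summable (\<lambda>k. norm (exp_term A k $ i $ j))"
proof (rule summable_comparison_test')
  define K where "K = (\<Sum>i\<in>UNIV. \<Sum>j\<in>UNIV. norm (A $ i $ j))"
  show "summable (\<lambda>k. K ^ k /\<^sub>R fact k)" by (rule summable_exp_generic)
  show "norm (norm (exp_term A k $ i $ j)) \<le> K ^ k /\<^sub>R fact k" if "k \<ge> 0" for k
    using norm_matrix_power_nth_le[of k A i j]
    by (simp add: exp_term_def norm_mult norm_divide K_def field_simps)
qed

lemma mat_exp_nth: "mat_exp A $ i $ j = (\<Sum>k. exp_term A k $ i $ j)"
proof -
  have "exp_term A sums (\<chi> i j. \<Sum>k. exp_term A k $ i $ j)"
    by (intro sums_matI)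
      (simp add: summable_sums[OF summable_norm_cancel[OF summable_norm_exp_term_nth]])
  then have "mat_exp A = (\<chi> i j. \<Sum>k. exp_term A k $ i $ j)"
    unfolding mat_exp_def exp_term_def[symmetric] by (simp add: sums_iff)
  then show ?thesis by simp
qed

section \<open>Conjugation by an exponential as the exponential of a commutator\<close>

lemma matrix_mult_sum_left:
  fixes A :: "complex ^ 'm::finite ^ 'm"
  shows "A ** (\<Sum>k\<in>K. f k) = (\<Sum>k\<in>K. A ** f k)"
  by (induction K rule: infinite_finite_induct)
    (simp_all add: matrix_matrix_mult_def vec_eq_iff sum.distrib distrib_left)

lemma matrix_mult_sum_right:
  fixes A :: "complex ^ 'm::finite ^ 'm"
  shows "(\<Sum>k\<in>K. f k) ** A = (\<Sum>k\<in>K. f k ** A)"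
  by (induction K rule: infinite_finite_induct)
    (simp_all add: matrix_matrix_mult_def vec_eq_iff sum.distrib distrib_right)

lemma matrix_mult_exp_term: "A ** exp_term A k = of_nat (Suc k) *\<^sub>C exp_term A (Suc k)"
  by (simp add: exp_term_def mat_scale_matrix_mult del: of_nat_Suc)

text \<open>Powers are built by multiplying on the left, so this version rests on \<open>A\<close>
  commuting with its own powers.\<close>

lemma exp_term_matrix_mult: "exp_term A k ** A = of_nat (Suc k) *\<^sub>C exp_term A (Suc k)"
proof -
  have "((**) A ^^ k) (mat 1) ** A = ((**) A ^^ Suc k) (mat 1)"
    by (induction k) (simp_all flip: matrix_mul_assoc)
  then show ?thesis
    by (simp add: exp_term_def mat_scale_matrix_mult del: of_nat_Suc)
qed

text \<open>Left multiplication by \<open>A\<close> and right multiplication by \<open>- A\<close>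
  commute and add up to \<open>commutator A\<close>; this is the binomial theorem for the power of
  their sum, divided by \<open>n!\<close>. The right-hand side is the degree \<open>n\<close> part
  of the Cauchy product for \<open>mat_exp A ** B ** mat_exp (- A)\<close>.\<close>

lemma commutator_power_div_fact:
  "(1 / fact n) *\<^sub>C ((commutator A ^^ n) B) =
     (\<Sum>k\<le>n. exp_term A k ** B ** exp_term (- A) (n - k))"
proof (induction n)
  case 0
  then show ?case by (simp add: exp_term_def)
next
  case (Suc n)
  define T where "T n k = exp_term A k ** B ** exp_term (- A) (n - k)" for n k
  have left: "A ** T n k = of_nat (Suc k) *\<^sub>C T (Suc n) (Suc k)" for k
  proof -
    have "A ** T n k = (A ** exp_term A k) ** B ** exp_term (- A) (n - k)"
      by (simp add: T_def matrix_mul_assoc)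
    then show ?thesis
      by (simp add: T_def matrix_mult_exp_term mat_scale_matrix_mult del: of_nat_Suc)
  qed
  have right: "T n k ** A = - (of_nat (Suc n - k) *\<^sub>C T (Suc n) k)" if "k \<le> n" for k
  proof -
    \<comment> \<open>Written as \<open>- (- A)\<close>, the right factor can be absorbed into the
      powers of \<open>- A\<close>.\<close>
    have "exp_term (- A) (n - k) ** A = - (exp_term (- A) (n - k) ** (- A))"
      by (simp add: matrix_matrix_mult_def vec_eq_iff sum_negf)
    also have "\<dots> = - (of_nat (Suc n - k) *\<^sub>C exp_term (- A) (Suc n - k))"
      using that by (simp add: exp_term_matrix_mult Suc_diff_le del: of_nat_Suc)
    finally have *: "exp_term (- A) (n - k) ** A = (- of_nat (Suc n - k)) *\<^sub>C exp_term (- A) (Suc n - k)"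
      by simp
    have "T n k ** A = exp_term A k ** B ** (exp_term (- A) (n - k) ** A)"
      by (simp add: T_def matrix_mul_assoc)
    then show ?thesis
      by (simp only: * mat_scale_matrix_mult) (simp only: T_def cmat.scale_minus_left)
  qed
  have "commutator A (\<Sum>k\<le>n. T n k) = (\<Sum>k\<le>n. A ** T n k) - (\<Sum>k\<le>n. T n k ** A)"
    by (simp add: commutator_def matrix_mult_sum_left matrix_mult_sum_right)
  also have "(\<Sum>k\<le>n. T n k ** A) = - (\<Sum>k\<le>n. of_nat (Suc n - k) *\<^sub>C T (Suc n) k)"
    unfolding sum_negf[symmetric] by (intro sum.cong refl right) simp
  \<comment> \<open>The added summand \<open>k = Suc n\<close> has coefficient 0.\<close>
  also have "(\<Sum>k\<le>n. of_nat (Suc n - k) *\<^sub>C T (Suc n) k) =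
      (\<Sum>k\<le>Suc n. of_nat (Suc n - k) *\<^sub>C T (Suc n) k)"
    by simp
  \<comment> \<open>After the index shift the new summand \<open>k = 0\<close> has coefficient
    0.\<close>
  also have "(\<Sum>k\<le>n. A ** T n k) = (\<Sum>k\<le>Suc n. of_nat k *\<^sub>C T (Suc n) k)"
    by (subst sum.atMost_Suc_shift) (simp add: left del: of_nat_Suc)
  \<comment> \<open>For \<open>k \<le> Suc n\<close> the coefficients \<open>k\<close> and
    \<open>Suc n - k\<close> add up to \<open>Suc n\<close>, which turns \<open>1 / (Suc n)!\<close>
    back into \<open>1 / n!\<close>.\<close>
  also have "\<dots> - - (\<Sum>k\<le>Suc n. of_nat (Suc n - k) *\<^sub>C T (Suc n) k) =
      (\<Sum>k\<le>Suc n. of_nat (Suc n) *\<^sub>C T (Suc n) k)"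
    unfolding diff_minus_eq_add sum.distrib[symmetric] cmat.scale_left_distrib[symmetric]
    by (intro sum.cong refl arg_cong2[where f = mat_scale])
      (simp flip: of_nat_add)
  finally have "commutator A (\<Sum>k\<le>n. T n k) = of_nat (Suc n) *\<^sub>C (\<Sum>k\<le>Suc n. T (Suc n) k)"
    by (simp only: cmat.scale_sum_right)
  moreover have "commutator A (z *\<^sub>C X) = z *\<^sub>C commutator A X" for z X
    by (simp add: commutator_def mat_scale_matrix_mult cmat.scale_right_diff_distrib)
  then have "(1 / fact (Suc n)) *\<^sub>C ((commutator A ^^ Suc n) B) =
      (1 / of_nat (Suc n)) *\<^sub>C commutator A ((1 / fact n) *\<^sub>C ((commutator A ^^ n) B))"
    by (simp add: mult.commute)
  ultimately have "(1 / fact (Suc n)) *\<^sub>C ((commutator A ^^ Suc n) B) =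
      (1 / of_nat (Suc n)) *\<^sub>C of_nat (Suc n) *\<^sub>C (\<Sum>k\<le>Suc n. T (Suc n) k)"
    by (simp only: Suc.IH[folded T_def])
  then show ?case
    by (simp add: T_def del: of_nat_Suc sum.atMost_Suc funpow.simps)
qed

text \<open>Each entry of the limit is a finite combination, over the inner indices \<open>l\<close>
  and \<open>m\<close>, of products of two absolutely convergent scalar series, whose Cauchy
  products are summed termwise.\<close>

lemma sums_commutator_exp:
  fixes A B :: "complex ^ 'm::finite ^ 'm"
  shows "(\<lambda>n. (1 / fact n) *\<^sub>C ((commutator A ^^ n) B)) sums (mat_exp A ** B ** mat_exp (- A))"
proof (rule sums_matI)
  fix i j :: 'm
  let ?a = "\<lambda>l k. exp_term A k $ i $ l" and ?b = "\<lambda>m k. exp_term (- A) k $ m $ j"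
  have "(\<lambda>n. \<Sum>m\<in>UNIV. \<Sum>l\<in>UNIV. B $ l $ m * (\<Sum>k\<le>n. ?a l k * ?b m (n - k))) sums
      (\<Sum>m\<in>UNIV. \<Sum>l\<in>UNIV. B $ l $ m * ((\<Sum>k. ?a l k) * (\<Sum>k. ?b m k)))"
    by (intro sums_sum sums_mult Cauchy_product_sums summable_norm_exp_term_nth)
  also have "(\<lambda>n. \<Sum>m\<in>UNIV. \<Sum>l\<in>UNIV. B $ l $ m * (\<Sum>k\<le>n. ?a l k * ?b m (n - k))) =
      (\<lambda>n. ((1 / fact n) *\<^sub>C ((commutator A ^^ n) B)) $ i $ j)"
  proof
    fix n
    have "((1 / fact n) *\<^sub>C ((commutator A ^^ n) B)) $ i $ j =
        (\<Sum>k\<le>n. \<Sum>m\<in>UNIV. \<Sum>l\<in>UNIV. B $ l $ m * (?a l k * ?b m (n - k)))"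
      unfolding commutator_power_div_fact
      by (simp add: matrix_matrix_mult_def sum_component sum_distrib_left sum_distrib_right mult_ac)
    also have "\<dots> = (\<Sum>m\<in>UNIV. \<Sum>l\<in>UNIV. \<Sum>k\<le>n. B $ l $ m * (?a l k * ?b m (n - k)))"
      by (subst sum.swap, subst (2) sum.swap) (rule refl)
    finally show "(\<Sum>m\<in>UNIV. \<Sum>l\<in>UNIV. B $ l $ m * (\<Sum>k\<le>n. ?a l k * ?b m (n - k))) =
        ((1 / fact n) *\<^sub>C ((commutator A ^^ n) B)) $ i $ j"
      by (simp add: sum_distrib_left)
  qed
  also have "(\<Sum>m\<in>UNIV. \<Sum>l\<in>UNIV. B $ l $ m * ((\<Sum>k. ?a l k) * (\<Sum>k. ?b m k))) =
      (mat_exp A ** B ** mat_exp (- A)) $ i $ j"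
    by (simp add: matrix_matrix_mult_def mat_exp_nth sum_distrib_left sum_distrib_right mult_ac)
  finally show "(\<lambda>n. ((1 / fact n) *\<^sub>C ((commutator A ^^ n) B)) $ i $ j) sums
      (mat_exp A ** B ** mat_exp (- A)) $ i $ j" .
qed

section \<open>Heisenberg evolution and invariant subspaces\<close>

lemma evolve_liouvillian_eq:
  "evolve (liouvillian H) A t =
     mat_exp ((\<i> * complex_of_real t) *\<^sub>C H) ** A ** mat_exp ((- \<i> * complex_of_real t) *\<^sub>C H)"
proof -
  \<comment> \<open>The factor \<open>\<i> * t\<close> moves into the Hamiltonian, so the exponent
    is itself a commutator.\<close>
  have "(\<lambda>B. (\<i> * complex_of_real t) *\<^sub>C liouvillian H B) = commutator ((\<i> * complex_of_real t) *\<^sub>C H)"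
    by (simp add: fun_eq_iff liouvillian_def commutator_def mat_scale_matrix_mult
        cmat.scale_right_diff_distrib)
  then show ?thesis
    using sums_unique[OF sums_commutator_exp[of "(\<i> * complex_of_real t) *\<^sub>C H" A]]
    by (simp add: evolve_def superop_exp_def)
qed

text \<open>All partial sums of the exponential series lie in \<open>V\<close>, and a subspace of a
  finite-dimensional space is closed.\<close>

lemma evolve_in_subspace:
  fixes A :: "'n::finite operator"
  assumes V: "cmat.subspace V" and L: "\<And>B. B \<in> V \<Longrightarrow> liouvillian H B \<in> V" and A: "A \<in> V"
  shows "evolve (liouvillian H) A t \<in> V"
proof -
  let ?A = "(\<i> * complex_of_real t) *\<^sub>C H"
  \<comment> \<open>\<open>closed_subspace\<close> concerns real subspaces, so real scaling is first
    expressed through complex scaling.\<close>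
  have "r *\<^sub>R B = complex_of_real r *\<^sub>C B" for r and B :: "'n operator"
    by (simp add: vec_eq_iff scaleR_conv_of_real[where 'a = complex])
  then have "subspace V"
    using V by (auto simp: subspace_def cmat.subspace_def)
  then have "closed V" by (rule closed_subspace)
  have A_eq: "commutator ?A B = (\<i> * complex_of_real t) *\<^sub>C liouvillian H B" for B
    by (simp add: liouvillian_def commutator_def mat_scale_matrix_mult
        cmat.scale_right_diff_distrib)
  have "(commutator ?A ^^ n) A \<in> V" for n
    by (induction n) (auto simp: A A_eq intro: cmat.subspace_scale[OF V] L)
  then have "(\<Sum>n<m. (1 / fact n) *\<^sub>C ((commutator ?A ^^ n) A)) \<in> V" for m
    by (intro cmat.subspace_sum[OF V] cmat.subspace_scale[OF V])
  moreover have "(\<lambda>m. \<Sum>n<m. (1 / fact n) *\<^sub>C ((commutator ?A ^^ n) A)) \<longlonglongrightarrow>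
      evolve (liouvillian H) A t"
    using sums_commutator_exp[of ?A A] by (simp add: sums_def evolve_liouvillian_eq)
  ultimately show ?thesis
    by (rule closed_sequentially[OF \<open>closed V\<close>])
qed

section \<open>Products and commutators of Pauli strings\<close>

lemma pauli_string_mult:
  "\<exists>z \<rho>. z \<noteq> 0 \<and> pauli_string \<sigma> ** pauli_string \<tau> = z *\<^sub>C pauli_string \<rho>"
proof -
  have "\<exists>z u. z \<noteq> 0 \<and> (\<forall>a b. (\<Sum>c\<in>UNIV. pauli_entry s a c * pauli_entry t c b) = z * pauli_entry u a b)"
    for s t
  proof -
    \<comment> \<open>The one-qubit multiplication table: two different non-identity letters give
      the third one, with phase \<open>\<i>\<close> in the cyclic order X, Y, Z and
      \<open>- \<i>\<close> otherwise.\<close>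
    define u where "u = (if s = Pauli_I then t else if t = Pauli_I then s
      else if s = t then Pauli_I
      else if Pauli_X \<notin> {s, t} then Pauli_X else if Pauli_Y \<notin> {s, t} then Pauli_Y else Pauli_Z)"
    define z where "z = (if s = Pauli_I \<or> t = Pauli_I \<or> s = t then 1
      else if (s, t) \<in> {(Pauli_X, Pauli_Y), (Pauli_Y, Pauli_Z), (Pauli_Z, Pauli_X)} then \<i> else - \<i>)"
    have "(\<Sum>c\<in>UNIV. pauli_entry s a c * pauli_entry t c b) = z * pauli_entry u a b" for a b
      by (cases s; cases t; cases a; cases b) (simp_all add: u_def z_def UNIV_bool)
    moreover have "z \<noteq> 0" by (simp add: z_def)
    ultimately show ?thesis by blast
  qed
  then obtain z u where zu: "\<And>s t. z s t \<noteq> (0 :: complex)"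
    "\<And>s t a b. (\<Sum>c\<in>UNIV. pauli_entry s a c * pauli_entry t c b) = z s t * pauli_entry (u s t) a b"
    by metis
  have "pauli_string \<sigma> ** pauli_string \<tau> =
      (\<Prod>m\<in>UNIV. z (\<sigma> m) (\<tau> m)) *\<^sub>C pauli_string (\<lambda>m. u (\<sigma> m) (\<tau> m))"
    by (simp add: vec_eq_iff pauli_string_mult_nth zu(2) prod.distrib) (simp add: pauli_string_def)
  moreover have "(\<Prod>m\<in>UNIV. z (\<sigma> m) (\<tau> m)) \<noteq> 0"
    by (simp add: zu(1))
  ultimately show ?thesis by blast
qed

text \<open>Pauli strings either commute or anticommute; in the second case the commutator is twice
  the product, again a Pauli string up to a nonzero factor.\<close>

lemma commutator_pauli_cases:
  assumes "g \<in> pauli_strings" "q \<in> pauli_strings"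
  obtains "commutator g q = 0"
    | z r where "z \<noteq> 0" "r \<in> pauli_strings" "commutator g q = z *\<^sub>C r"
proof -
  from assms obtain \<sigma> \<tau> where [simp]: "g = pauli_string \<sigma>" "q = pauli_string \<tau>"
    by (auto simp: pauli_strings_def)
  obtain z \<rho> where z: "z \<noteq> 0" "g ** q = z *\<^sub>C pauli_string \<rho>"
    using pauli_string_mult[of \<sigma> \<tau>] by auto
  consider "q ** g = g ** q" | "q ** g = - (g ** q)"
    using pauli_string_commute_or_anticommute[of \<tau> \<sigma>] by auto
  then show ?thesis
  proof cases
    case 1
    then show ?thesis by (intro that(1)) (simp add: commutator_def)
  next
    case 2
    then have "commutator g q = (2 * z) *\<^sub>C pauli_string \<rho>"
      using z(2) by (simp add: commutator_def vec_eq_iff)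
    with z(1) show ?thesis
      by (intro that(2)[of "2 * z" "pauli_string \<rho>"]) (auto simp: pauli_strings_def)
  qed
qed

section \<open>The operator inner product and diagonal superoperators\<close>

lemma op_inner_eq_sum:
  "op_inner A B = (1 / 2 ^ CARD('n::finite)) *
     (\<Sum>i\<in>UNIV. \<Sum>j\<in>UNIV. cnj ((A :: 'n operator) $ j $ i) * B $ j $ i)"
  by (simp add: op_inner_def trace_def matrix_matrix_mult_def adjoint_mat_def)

lemma op_inner_add_right: "op_inner A (B + C) = op_inner A B + op_inner A C"
  by (simp add: op_inner_eq_sum sum.distrib distrib_left)

lemma op_inner_scale_right: "op_inner A (z *\<^sub>C B) = z * op_inner A B"
  by (simp add: op_inner_eq_sum sum_distrib_left mult_ac)

lemma op_inner_zero_right: "op_inner A 0 = 0"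
  by (simp add: op_inner_eq_sum)

lemma op_inner_sum_right: "op_inner A (\<Sum>k\<in>K. f k) = (\<Sum>k\<in>K. op_inner A (f k))"
  by (induction K rule: infinite_finite_induct)
    (simp_all add: op_inner_add_right op_inner_zero_right)

lemma op_inner_commute: "op_inner A B = cnj (op_inner B A)"
  by (simp add: op_inner_eq_sum mult.commute)

text \<open>The two overlaps of \<open>A\<close> with \<open>a\<close> are complex conjugates, so
  their product is a squared modulus. This gives both positivity of a superoperator with nonnegative
  weights and the value of the complexity.\<close>

lemma op_inner_diagonal:
  "op_inner A (\<Sum>a\<in>E. (complex_of_real (w a) * op_inner a A) *\<^sub>C a) =
     complex_of_real (\<Sum>a\<in>E. w a * (cmod (op_inner a A))\<^sup>2)"
  unfolding op_inner_sum_right op_inner_scale_right of_real_sum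
proof (intro sum.cong refl)
  fix a
  have "op_inner a A * op_inner A a = complex_of_real ((cmod (op_inner a A))\<^sup>2)"
    by (simp only: op_inner_commute[of A a] complex_norm_square)
  then show "complex_of_real (w a) * op_inner a A * op_inner A a =
      complex_of_real (w a * (cmod (op_inner a A))\<^sup>2)"
    by (simp add: mult.assoc)
qed

lemma op_inner_orthonormal_sum:
  assumes "finite E" "\<And>a b. a \<in> E \<Longrightarrow> b \<in> E \<Longrightarrow> op_inner a b = (if a = b then 1 else 0)" "b \<in> E"
  shows "op_inner b (\<Sum>a\<in>E. c a *\<^sub>C a) = c b"
  using assms
  by (simp add: op_inner_sum_right op_inner_scale_right if_distrib[of "(*) _"] cong: if_cong)

lemma op_inner_pauli_strings:
  assumes "a \<in> pauli_strings" "b \<in> pauli_strings"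
  shows "op_inner a b = (if a = b then 1 else 0)"
  using assms by (auto simp: pauli_strings_def op_inner_pauli_string)

section \<open>The Liouvillian on the span of the component\<close>

lemma liouvillian_sum:
  "liouvillian (\<Sum>g\<in>G. f g *\<^sub>C g) A = (\<Sum>g\<in>G. f g *\<^sub>C commutator g A)"
  by (simp add: liouvillian_def commutator_def matrix_mult_sum_left matrix_mult_sum_right
      mat_scale_matrix_mult cmat.scale_right_diff_distrib sum_subtractf)

lemma liouvillian_add: "liouvillian H (A + B) = liouvillian H A + liouvillian H B"
  by (simp add: liouvillian_def commutator_def matrix_matrix_mult_def vec_eq_iff
      sum.distrib distrib_left distrib_right)

lemma liouvillian_scale: "liouvillian H (z *\<^sub>C A) = z *\<^sub>C liouvillian H A"
  by (simp add: liouvillian_def commutator_def mat_scale_matrix_mult cmat.scale_right_diff_distrib)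

lemma liouvillian_zero: "liouvillian H 0 = 0"
  by (simp add: liouvillian_def commutator_def matrix_matrix_mult_def vec_eq_iff)

text \<open>A nonzero commutator is a multiple of some Pauli string \<open>r\<close>, which makes
  \<open>(q, r)\<close> an arc and keeps \<open>r\<close> in the component.\<close>

lemma commutator_in_span_component:
  assumes "\<G> \<subseteq> pauli_strings" "g \<in> \<G>" "q \<in> component \<G> p"
  shows "commutator g q \<in> cmat.span (component \<G> p)"
proof -
  have q: "q \<in> pauli_strings" using component_subset[OF assms(1)] assms(3) by blast
  have g: "g \<in> pauli_strings" using assms(1,2) by blast
  show ?thesis
  proof (rule commutator_pauli_cases[OF g q])
    fix z r
    assume r: "z \<noteq> 0" "r \<in> pauli_strings" "commutator g q = z *\<^sub>C r"
    then have "(q, r) \<in> parcs (commutator_graph \<G>)"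
      using q assms(2) by (auto simp: commutator_graph_def)
    with component_closed[OF assms(1,3)] show ?thesis
      by (simp add: r(3) cmat.span_base cmat.span_scale)
  qed (simp add: cmat.span_zero)
qed

text \<open>The neighbour of \<open>b\<close> reached by \<open>g\<close> has distance within 1 of
  that of \<open>b\<close>, so it differs from \<open>a\<close> and is orthogonal to it.\<close>

lemma op_inner_commutator_far:
  assumes "\<G> \<subseteq> pauli_strings" "g \<in> \<G>" "a \<in> component \<G> p" "b \<in> component \<G> p"
    and far: "\<bar>real (graph_dist \<G> p a) - real (graph_dist \<G> p b)\<bar> > 1"
  shows "op_inner a (commutator g b) = 0"
proof -
  have ab: "a \<in> pauli_strings" "b \<in> pauli_strings"
    using component_subset[OF assms(1)] assms(3,4) by blast+
  have g: "g \<in> pauli_strings" using assms(1,2) by blast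
  show ?thesis
  proof (rule commutator_pauli_cases[OF g ab(2)])
    fix z r
    assume r: "z \<noteq> 0" "r \<in> pauli_strings" "commutator g b = z *\<^sub>C r"
    then have "(b, r) \<in> parcs (commutator_graph \<G>)"
      using ab assms(2) by (auto simp: commutator_graph_def)
    with graph_dist_arc[OF assms(1,4)] far have "a \<noteq> r" by fastforce
    with r ab show ?thesis
      by (simp add: op_inner_scale_right op_inner_pauli_strings)
  qed (simp add: op_inner_zero_right)
qed

section \<open>The graph complexity as the expectation value of a diagonal superoperator\<close>

theorem lemma8:
  fixes \<G> :: "'n::finite operator set"
    and h :: "'n operator \<Rightarrow> real"
    and H p :: "'n operator"
    and p\<^sub>t :: "real \<Rightarrow> 'n operator"
  assumes "\<G> \<subseteq> pauli_strings"
    and "p \<in> pauli_strings"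
    and "H = (\<Sum>g\<in>\<G>. complex_of_real (h g) *\<^sub>C g)"
    and "\<And>t. p\<^sub>t t = mat_exp ((\<i> * complex_of_real t) *\<^sub>C H) ** p ** mat_exp ((- \<i> * complex_of_real t) *\<^sub>C H)"
  shows "(\<exists>c. \<forall>t. p\<^sub>t t = (\<Sum>q\<in>component \<G> p. c t q *\<^sub>C q)) \<and>
    (\<forall>c. (\<forall>t. p\<^sub>t t = (\<Sum>q\<in>component \<G> p. c t q *\<^sub>C q)) \<longrightarrow>
      q_complexity_on (cmat.span (component \<G> p)) (liouvillian H) p (\<lambda>t. graph_complexity \<G> p (c t)))"
proof -
  define C where "C = component \<G> p"
  define V where "V = cmat.span C"
  define \<l> where "\<l> q = real (graph_dist \<G> p q)" for q
  define Q where "Q A = (\<Sum>q\<in>C. (complex_of_real (\<l> q) * op_inner q A) *\<^sub>C q)" for A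
  have CP: "C \<subseteq> pauli_strings" unfolding C_def by (rule component_subset[OF assms(1)])
  have finC: "finite C" using finite_pauli_strings by (rule finite_subset[OF CP])
  have pC: "p \<in> C" unfolding C_def by (rule self_in_component[OF assms(1,2)])
  have orth: "op_inner a b = (if a = b then 1 else 0)" if "a \<in> C" "b \<in> C" for a b
    using that CP by (intro op_inner_pauli_strings) auto
  have V: "cmat.subspace V" unfolding V_def by (rule cmat.subspace_span)
  have CV: "q \<in> V" if "q \<in> C" for q unfolding V_def using that by (rule cmat.span_base)
  have L_eq: "liouvillian H A = (\<Sum>g\<in>\<G>. complex_of_real (h g) *\<^sub>C commutator g A)" for A
    unfolding assms(3) by (rule liouvillian_sum)
  \<comment> \<open>By linearity it suffices to treat the spanning Pauli strings.\<close>
  have LV: "liouvillian H A \<in> V" if "A \<in> V" for A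
    using that[unfolded V_def]
  proof (induction rule: cmat.span_induct_alt)
    case (step z q A)
    have "liouvillian H q \<in> V"
      unfolding L_eq V_def C_def using commutator_in_span_component[OF assms(1)] step(1)
      by (intro cmat.span_sum cmat.span_scale) (auto simp: C_def)
    with step.IH show ?case
      by (simp add: liouvillian_add liouvillian_scale cmat.subspace_add[OF V] cmat.subspace_scale[OF V])
  qed (simp add: liouvillian_zero cmat.subspace_0[OF V])
  have sop_L: "superoperator_on V (liouvillian H)"
    by (simp add: superoperator_on_def LV liouvillian_add liouvillian_scale)
  have evolve: "evolve (liouvillian H) p t = p\<^sub>t t" for t
    by (simp add: evolve_liouvillian_eq assms(4))
  have "\<exists>c. p\<^sub>t t = (\<Sum>q\<in>C. c q *\<^sub>C q)" for t
  proof -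
    have "p\<^sub>t t \<in> V"
      unfolding evolve[symmetric] by (rule evolve_in_subspace[OF V LV CV[OF pC]])
    then show ?thesis
      unfolding V_def cmat.span_finite[OF finC] image_iff by simp
  qed
  \<comment> \<open>The coefficients are chosen for each time separately.\<close>
  then have ex: "\<exists>c. \<forall>t. p\<^sub>t t = (\<Sum>q\<in>C. c t q *\<^sub>C q)"
    by (intro choice allI)
  have QV: "Q A \<in> V" for A
    unfolding Q_def by (intro cmat.subspace_sum[OF V] cmat.subspace_scale[OF V] CV)
  have sop_Q: "superoperator_on V Q"
    by (simp add: superoperator_on_def QV)
      (simp add: Q_def op_inner_add_right op_inner_scale_right distrib_left cmat.scale_left_distrib
        sum.distrib cmat.scale_sum_right mult.left_commute)
  have inner_Q: "op_inner A (Q A) = complex_of_real (\<Sum>q\<in>C. \<l> q * (cmod (op_inner q A))\<^sup>2)" for A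
    unfolding Q_def by (rule op_inner_diagonal)
  have psd: "psd_on V Q"
    unfolding psd_on_def inner_Q nonneg_Reals_of_real_iff
    by (auto simp: \<l>_def intro!: sum_nonneg)
  have spec: "spectral_decomposition V Q C \<l>"
    unfolding spectral_decomposition_def orthonormal_basis_of_def
    by (simp add: orth V_def Q_def)
  have local: "op_inner a (liouvillian H b) = 0" if "a \<in> C" "b \<in> C" "\<bar>\<l> a - \<l> b\<bar> > 1" for a b
    using op_inner_commutator_far[OF assms(1)] that
    by (simp add: L_eq op_inner_sum_right op_inner_scale_right C_def \<l>_def)
  \<comment> \<open>Only \<open>p\<close> itself overlaps with \<open>p\<close>, and its eigenvalue
    is \<open>\<ell>(p, p) = 0\<close>.\<close>
  have init: "op_inner a p = 0" if "a \<in> C" "\<bar>\<l> a\<bar> > 1" for a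
    using that pC graph_dist_self[OF assms(1,2)] by (auto simp: orth \<l>_def)
  have "q_complexity_on V (liouvillian H) p (\<lambda>t. graph_complexity \<G> p (c t))"
    if c: "\<forall>t. p\<^sub>t t = (\<Sum>q\<in>C. c t q *\<^sub>C q)" for c
  proof -
    \<comment> \<open>Orthonormality forces the coefficients of any given expansion to be the
      overlaps with \<open>p\<^sub>t t\<close>, so the weighted sum of their squared moduli is the
      expectation value of \<open>Q\<close>.\<close>
    have "op_inner q (p\<^sub>t t) = c t q" if "q \<in> C" for q t
      unfolding c[rule_format] using finC orth that by (rule op_inner_orthonormal_sum)
    then have val: "complex_of_real (graph_complexity \<G> p (c t)) =
        op_inner (evolve (liouvillian H) p t) (Q (evolve (liouvillian H) p t))" for t
      unfolding inner_Q evolve graph_complexity_def C_def[symmetric] \<l>_def by simp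
    have "\<forall>a\<in>C. \<l> a \<ge> 0" by (simp add: \<l>_def)
    moreover have "\<exists>M>0. (\<forall>a\<in>C. \<forall>b\<in>C. \<bar>\<l> a - \<l> b\<bar> > M \<longrightarrow> op_inner a (liouvillian H b) = 0) \<and>
        (\<forall>a\<in>C. \<bar>\<l> a\<bar> > M \<longrightarrow> op_inner a p = 0)"
      using local init by (intro exI[of _ 1]) auto
    ultimately show ?thesis
      unfolding q_complexity_on_def using V sop_L CV[OF pC] sop_Q psd spec val
      by (intro conjI exI[of _ Q] exI[of _ C] exI[of _ \<l>]) simp_all
  qed
  with ex show ?thesis
    unfolding V_def C_def by (intro conjI allI impI)
qed

end
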